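(* Let $S_n$ be a star on $n\ge 2$ vertices and let $k\geq 2$. Then the spectrum of the Seidel matrix of the hyperstar $S_n^k$ is $$\sigma_S(S_n^k)=\begin{pmatrix}1 & 3-2k & r_1 & r_2\\ (n-1)(k-2) & n-2 & 1 & 1\end{pmatrix},$$ where $r_1$ and $r_2$ are the roots of the equation $$\lambda^2-((k-1)(n-3)+1)\lambda-(n-1)(k-1)=0.$$
   Context: A hypergraph $G^*=(V,E)$ has a finite vertex set $V=\{v_1,\dots,v_N\}$ and a finite set $E$ of hyperedges, each a subset of $V$. Its adjacency matrix $A=(a_{ij})$ has $a_{ij}=|\{e\in E:\{v_i,v_j\}\subset e\}|$ for $i\ne j$ and $a_{ii}=0$. Its Seidel matrix is $S=J_N-I_N-2A$ ($J_N$ all-ones matrix, $I_N$ identity). The hyperstar $S_n^k$ has the $(n-1)(k-1)+1$ vertices $v_{0,0}$ and $v_{i,j}$ ($1\le i\le n-1$, $1\le j\le k-1$), and the $n-1$ hyperedges $\{v_{0,0},v_{i,1},v_{i,2},\dots,v_{i,k-1}\}$, $1\le i\le n-1$. The two-row notation for a spectrum lists eigenvalues in the first row and multiplicities in the second; it is read as a multiset (if listed values coincide, their multiplicities add, and multiplicity $0$ means the entry is absent). *)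

theory Defs
  imports "Jordan_Normal_Form.Char_Poly"
begin

definition hypergraph :: "'a set \<Rightarrow> 'a set set \<Rightarrow> bool" where
  "hypergraph V E \<longleftrightarrow> finite V \<and> finite E \<and> (\<forall>e\<in>E. e \<subseteq> V)"

text \<open>The vertex set of a hypergraph is presented as \<open>V = {v\<^sub>1, \<dots>, v\<^sub>N}\<close>; the numbering used to
  index the matrices is given by a list \<open>vs\<close> that is \<open>distinct\<close> with \<open>set vs = V\<close>.\<close>

definition adjacency_mat :: "'a list \<Rightarrow> 'a set set \<Rightarrow> real mat" where
  "adjacency_mat vs E = mat (length vs) (length vs)
     (\<lambda>(i, j). if i = j then 0 else real (card {e \<in> E. {vs ! i, vs ! j} \<subseteq> e}))"

definition all_ones_mat :: "nat \<Rightarrow> real mat" where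
  "all_ones_mat N = mat N N (\<lambda>_. 1)"

definition seidel_mat :: "'a list \<Rightarrow> 'a set set \<Rightarrow> real mat" where
  "seidel_mat vs E =
     all_ones_mat (length vs) - 1\<^sub>m (length vs) - 2 \<cdot>\<^sub>m adjacency_mat vs E"

text \<open>The multiset of eigenvalues, each repeated according to its algebraic multiplicity.
  Only real eigenvalues are collected; for a real symmetric matrix these are all of them.\<close>

definition mat_spectrum :: "real mat \<Rightarrow> real multiset" where
  "mat_spectrum A = proots (char_poly A)"

definition seidel_spectrum :: "'a list \<Rightarrow> 'a set set \<Rightarrow> real multiset" where
  "seidel_spectrum vs E = mat_spectrum (seidel_mat vs E)"

text \<open>The hyperstar \<open>S\<^sub>n\<^sup>k\<close>: the pair \<open>(i, j)\<close> stands for the vertex \<open>v\<^bsub>i,j\<^esub>\<close>.\<close>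

definition hyperstar_verts :: "nat \<Rightarrow> nat \<Rightarrow> (nat \<times> nat) set" where
  "hyperstar_verts n k = insert (0, 0) ({1..n - 1} \<times> {1..k - 1})"

definition hyperstar_edges :: "nat \<Rightarrow> nat \<Rightarrow> (nat \<times> nat) set set" where
  "hyperstar_edges n k = (\<lambda>i. insert (0, 0) ((\<lambda>j. (i, j)) ` {1..k - 1})) ` {1..n - 1}"

lemma hypergraph_hyperstar: "hypergraph (hyperstar_verts n k) (hyperstar_edges n k)"
  by (auto simp: hypergraph_def hyperstar_verts_def hyperstar_edges_def)

lemma card_hyperstar_verts: "card (hyperstar_verts n k) = (n - 1) * (k - 1) + 1"
  by (simp add: hyperstar_verts_def card_cartesian_product)

lemma card_hyperstar_edges:
  assumes "k \<ge> 2"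
  shows "card (hyperstar_edges n k) = n - 1"
proof -
  have "inj_on (\<lambda>i. insert (0, 0) ((\<lambda>j. (i, j)) ` {1..k - 1})) {1..n - 1}"
  proof (rule inj_onI)
    fix a b :: nat
    assume "a \<in> {1..n - 1}" and "b \<in> {1..n - 1}"
      and eq: "insert (0, 0) ((\<lambda>j. (a, j)) ` {1..k - 1}) =
        insert (0::nat, 0::nat) ((\<lambda>j. (b, j)) ` {1..k - 1})"
    have "(a, 1) \<in> insert (0, 0) ((\<lambda>j. (a, j)) ` {1..k - 1})"
      using assms by auto
    then show "a = b"
      unfolding eq by auto
  qed
  then show ?thesis
    unfolding hyperstar_edges_def by (simp add: card_image)
qed

lemma transpose_seidel_mat: "transpose_mat (seidel_mat vs E) = seidel_mat vs E"
  by (rule eq_matI)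
    (auto simp: seidel_mat_def all_ones_mat_def adjacency_mat_def conj_commute)

end

theory Submission
  imports Defs
begin

text \<open>Make the non-central vertices into a rooted tree in which \<open>(1, 1)\<close> is the parent of every other
  \<open>(i, 1)\<close>, and \<open>(i, 1)\<close> is the parent of \<open>(i, j)\<close> for \<open>j \<ge> 2\<close>. Use the basis \<open>p\<^sub>b = e\<^sub>b - e\<^bsub>parent b\<^esub>\<close>, with
  \<open>p\<^sub>b = e\<^sub>b\<close> for \<open>b = (0, 0)\<close> and \<open>b = (1, 1)\<close>. Vertices in a common block are twins, so \<open>p\<^bsub>i,j\<^esub>\<close> with
  \<open>j \<ge> 2\<close> is an eigenvector for \<open>1\<close>; modulo these, \<open>p\<^bsub>i,1\<^esub>\<close> with \<open>i \<ge> 2\<close> is an eigenvector for \<open>3 - 2k\<close>,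
  and on the remaining two-dimensional quotient the Seidel matrix acts with the stated quadratic as
  its characteristic polynomial.\<close>

section \<open>Matrices with labelled rows and columns, and their characteristic polynomials\<close>

text \<open>Matrices indexed by lists of labels, so that a change of basis can at the same time pass from
  an arbitrary numbering of the vertices to a convenient one.\<close>

definition fun_mat :: "'a list \<Rightarrow> 'b list \<Rightarrow> ('a \<Rightarrow> 'b \<Rightarrow> 'c) \<Rightarrow> 'c mat" where
  "fun_mat xs ys F = mat (length xs) (length ys) (\<lambda>(i, j). F (xs ! i) (ys ! j))"

lemma fun_mat_carrier [simp]: "fun_mat xs ys F \<in> carrier_mat (length xs) (length ys)"
  by (simp add: fun_mat_def)

lemma dim_fun_mat [simp]:
  "dim_row (fun_mat xs ys F) = length xs" "dim_col (fun_mat xs ys F) = length ys"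
  by (simp_all add: fun_mat_def)

lemma index_fun_mat [simp]:
  "i < length xs \<Longrightarrow> j < length ys \<Longrightarrow> fun_mat xs ys F $$ (i, j) = F (xs ! i) (ys ! j)"
  by (simp add: fun_mat_def)

lemma fun_mat_cong:
  assumes "\<And>a b. a \<in> set xs \<Longrightarrow> b \<in> set ys \<Longrightarrow> F a b = G a b"
  shows "fun_mat xs ys F = fun_mat xs ys G"
  by (rule eq_matI) (auto simp: assms)

lemma fun_mat_mult:
  fixes F :: "'a \<Rightarrow> 'b \<Rightarrow> 'd::comm_semiring_1"
  assumes "distinct ys"
  shows "fun_mat xs ys F * fun_mat ys zs G = fun_mat xs zs (\<lambda>a b. \<Sum>c\<in>set ys. F a c * G c b)"
proof (rule eq_matI)
  fix i j
  assume "i < dim_row (fun_mat xs zs (\<lambda>a b. \<Sum>c\<in>set ys. F a c * G c b))"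
    and "j < dim_col (fun_mat xs zs (\<lambda>a b. \<Sum>c\<in>set ys. F a c * G c b))"
  then have ij: "i < length xs" "j < length zs" by simp_all
  have "(\<Sum>c\<in>set ys. F (xs ! i) c * G c (zs ! j)) =
      (\<Sum>l<length ys. F (xs ! i) (ys ! l) * G (ys ! l) (zs ! j))"
    by (rule sum.reindex_bij_betw [symmetric]) (simp add: assms bij_betw_nth)
  then show "(fun_mat xs ys F * fun_mat ys zs G) $$ (i, j) =
      fun_mat xs zs (\<lambda>a b. \<Sum>c\<in>set ys. F a c * G c b) $$ (i, j)"
    using ij by (simp add: scalar_prod_def atLeast0LessThan)
qed auto

lemma fun_mat_one:
  assumes "distinct xs"
  shows "fun_mat xs xs (\<lambda>a b. of_bool (a = b)) = 1\<^sub>m (length xs)"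
  by (rule eq_matI) (auto simp: nth_eq_iff_index_eq [OF assms])

text \<open>\<open>Q\<close> is a left inverse of \<open>P\<close>, hence two-sided because both are
  square of the same size; so the two matrices are similar.\<close>

lemma char_poly_fun_mat_change_basis:
  fixes F :: "'a \<Rightarrow> 'a \<Rightarrow> 'd::field"
  assumes xs: "distinct xs" and ys: "distinct ys" and len: "length xs = length ys"
    and QP: "\<And>a b. a \<in> set ys \<Longrightarrow> b \<in> set ys \<Longrightarrow>
      (\<Sum>c\<in>set xs. Q a c * P c b) = of_bool (a = b)"
  shows "char_poly (fun_mat xs xs F) =
    char_poly (fun_mat ys ys (\<lambda>a b. \<Sum>d\<in>set xs. (\<Sum>c\<in>set xs. Q a c * F c d) * P d b))"
proof -
  let ?Q = "fun_mat ys xs Q" and ?P = "fun_mat xs ys P" and ?F = "fun_mat xs xs F"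
  have "?Q * ?P = fun_mat ys ys (\<lambda>a b. of_bool (a = b))"
    unfolding fun_mat_mult [OF xs] by (rule fun_mat_cong) (rule QP)
  then have QP1: "?Q * ?P = 1\<^sub>m (length ys)"
    by (simp add: fun_mat_one [OF ys])
  have Q: "?Q \<in> carrier_mat (length ys) (length ys)" and P: "?P \<in> carrier_mat (length ys) (length ys)"
    by (simp_all add: fun_mat_def len)
  have "similar_mat (?Q * ?F * ?P) ?F"
    by (rule similar_matI [OF _ QP1 mat_mult_left_right_inverse [OF Q P QP1]])
      (auto simp: fun_mat_def len)
  then show ?thesis
    by (simp add: fun_mat_mult [OF xs] char_poly_similar)
qed

text \<open>The characteristic matrix is block lower triangular, so its determinant is the product
  over the diagonal blocks, whatever stands below them.\<close>

lemma char_poly_fun_mat_append: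
  fixes F :: "'a \<Rightarrow> 'a \<Rightarrow> 'd::idom"
  assumes "\<And>a b. a \<in> set xs \<Longrightarrow> b \<in> set ys \<Longrightarrow> F a b = 0"
  shows "char_poly (fun_mat (xs @ ys) (xs @ ys) F) =
    char_poly (fun_mat xs xs F) * char_poly (fun_mat ys ys F)"
proof -
  have "char_poly_matrix (fun_mat (xs @ ys) (xs @ ys) F) =
      four_block_mat (char_poly_matrix (fun_mat xs xs F)) (0\<^sub>m (length xs) (length ys))
        (fun_mat ys xs (\<lambda>a b. [:- F a b:])) (char_poly_matrix (fun_mat ys ys F))"
    by (rule eq_matI) (auto simp: char_poly_matrix_def nth_append assms)
  then show ?thesis
    unfolding char_poly_def
    by (simp add: det_four_block_mat_upper_right_zero [OF _ refl]
        char_poly_matrix_closed [OF fun_mat_carrier])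
qed

lemma char_poly_fun_mat_diag:
  fixes F :: "'a \<Rightarrow> 'a \<Rightarrow> 'd::idom"
  assumes "distinct xs"
    and "\<And>a b. a \<in> set xs \<Longrightarrow> b \<in> set xs \<Longrightarrow> F a b = (if a = b then x else 0)"
  shows "char_poly (fun_mat xs xs F) = [:- x, 1:] ^ length xs"
proof -
  have "char_poly (fun_mat xs xs F) = (\<Prod>a\<leftarrow>diag_mat (fun_mat xs xs F). [:- a, 1:])"
    by (rule char_poly_upper_triangular [OF fun_mat_carrier])
      (auto simp: assms nth_eq_iff_index_eq)
  also have "diag_mat (fun_mat xs xs F) = replicate (length xs) x"
    by (rule nth_equalityI) (auto simp: diag_mat_def assms)
  finally show ?thesis by simp
qed

lemma det_2x2:
  fixes A :: "'d::comm_ring_1 mat"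
  assumes "A \<in> carrier_mat 2 2"
  shows "det A = A $$ (0, 0) * A $$ (1, 1) - A $$ (0, 1) * A $$ (1, 0)"
proof -
  \<comment> \<open>The minor is a single entry: removing index \<open>0\<close> leaves index
    \<open>1\<close>, and otherwise index \<open>0\<close> is left.\<close>
  have "det (mat_delete A i j) = A $$ (if 0 < i then 0 else 1, if 0 < j then 0 else 1)" for i j
    using mat_delete_carrier [OF assms, of i j] assms
    by (simp add: det_single) (simp add: mat_delete_def)
  then show ?thesis
    using laplace_expansion_row [OF assms, of 0]
    by (simp add: cofactor_def numeral_2_eq_2)
qed

lemma char_poly_fun_mat_pair:
  fixes F :: "'a \<Rightarrow> 'a \<Rightarrow> 'd::comm_ring_1"
  shows "char_poly (fun_mat [x, y] [x, y] F) =
    [:F x x * F y y - F x y * F y x, - (F x x + F y y), 1:]"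
proof -
  have "char_poly_matrix (fun_mat [x, y] [x, y] F) \<in> carrier_mat 2 2"
    using char_poly_matrix_closed [OF fun_mat_carrier, of "[x, y]" F] by (simp add: numeral_2_eq_2)
  from det_2x2 [OF this] show ?thesis
    by (simp add: char_poly_defs algebra_simps)
qed

section \<open>Roots of the polynomial factors\<close>

lemma proots_linear_power:
  fixes c :: "'a::idom"
  shows "proots ([:- c, 1:] ^ m) = replicate_mset m c"
  by (simp add: proots_power)

text \<open>The discriminant \<open>b\<^sup>2 + 4 * c\<close> is nonnegative, so the quadratic
  formula gives real roots.\<close>

lemma quadratic_nonpos_constant_factors:
  fixes b c :: real
  assumes "c \<ge> 0"
  obtains r1 r2 where "[:- c, - b, 1:] = [:- r1, 1:] * [:- r2, 1:]"
proof
  define w where "w = sqrt (b\<^sup>2 + 4 * c)"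
  have "w * w = b * b + 4 * c"
    using assms by (simp add: w_def flip: power2_eq_square)
  then show "[:- c, - b, 1:] = [:- ((b + w) / 2), 1:] * [:- ((b - w) / 2), 1:]"
    by (simp add: field_simps)
qed

section \<open>Entries of the Seidel matrix of the hyperstar\<close>

text \<open>Off the diagonal a Seidel entry is 1 minus twice the number of common edges, and two
  distinct vertices of the hyperstar share at most one edge.\<close>

definition hyperstar_seidel :: "nat \<times> nat \<Rightarrow> nat \<times> nat \<Rightarrow> real" where
  "hyperstar_seidel c d =
     (if c = d then 0 else if c = (0, 0) \<or> d = (0, 0) \<or> fst c = fst d then - 1 else 1)"

text \<open>The cases are the roles in the tree: \<open>top\<close> is the root of the whole tree,
  \<open>root\<close> the head of another block, \<open>leaf\<close> any later vertex of a block,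
  including block 1.\<close>

lemma hyperstar_verts_cases [consumes 1, case_names center top root leaf]:
  assumes "a \<in> hyperstar_verts n k"
  obtains "a = (0, 0)" | "a = (1, 1)"
    | i where "a = (i, 1)" "i \<in> {2..n - 1}"
    | i j where "a = (i, j)" "i \<in> {1..n - 1}" "j \<in> {2..k - 1}"
proof -
  consider "a = (0, 0)" | i j where "a = (i, j)" "i \<in> {1..n - 1}" "j \<in> {1..k - 1}"
    using assms by (auto simp: hyperstar_verts_def)
  then show thesis
  proof cases
    case 1
    then show thesis by (rule that)
  next
    case (2 i j)
    then consider "i = 1" "j = 1" | "i \<in> {2..n - 1}" "j = 1" | "j \<in> {2..k - 1}"
      by fastforce
    then show thesis
      by cases (use 2 that in auto)
  qed
qed

text \<open>A noncentral vertex lies only in the edge named by its first coordinate. Of two distinct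
  vertices at least one is noncentral, so a single candidate edge remains.\<close>

lemma card_hyperstar_edges_containing:
  assumes c: "c \<in> hyperstar_verts n k" and d: "d \<in> hyperstar_verts n k" and ne: "c \<noteq> d"
  shows "card {e \<in> hyperstar_edges n k. {c, d} \<subseteq> e} =
    of_bool (c = (0, 0) \<or> d = (0, 0) \<or> fst c = fst d)"
proof -
  let ?edge = "\<lambda>i. insert (0, 0) ((\<lambda>j. (i, j)) ` {1..k - 1})"
  \<comment> \<open>For a vertex the range of the second coordinate is automatic, so only the first
    coordinate is tested.\<close>
  have mem: "x \<in> ?edge i \<longleftrightarrow> x = (0, 0) \<or> fst x = i" if "x \<in> hyperstar_verts n k" for x i
    using that by (cases x) (auto simp: hyperstar_verts_def)
  have sub: "{c, d} \<subseteq> ?edge i \<longleftrightarrow> (c = (0, 0) \<or> fst c = i) \<and> (d = (0, 0) \<or> fst d = i)" for i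
    unfolding insert_subset using mem [OF c, of i] mem [OF d, of i] by simp
  have E: "{e \<in> hyperstar_edges n k. {c, d} \<subseteq> e} =
      ?edge ` {i \<in> {1..n - 1}. (c = (0, 0) \<or> fst c = i) \<and> (d = (0, 0) \<or> fst d = i)}"
    by (simp only: hyperstar_edges_def Compr_image_eq sub)
  have fst: "x = (0, 0) \<or> fst x \<in> {1..n - 1}" if "x \<in> hyperstar_verts n k" for x
    using that by (auto simp: hyperstar_verts_def)
  show ?thesis
  proof (cases "c = (0, 0) \<or> d = (0, 0) \<or> fst c = fst d")
    case True
    define i where "i = (if c = (0, 0) then fst d else fst c)"
    have "i \<in> {1..n - 1}" "c = (0, 0) \<or> fst c = i" "d = (0, 0) \<or> fst d = i"
      and "c \<noteq> (0, 0) \<or> d \<noteq> (0, 0)"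
      using True ne fst [OF c] fst [OF d] unfolding i_def by metis+
    then have "x \<in> {1..n - 1} \<and> (c = (0, 0) \<or> fst c = x) \<and> (d = (0, 0) \<or> fst d = x) \<longleftrightarrow> x = i" for x
      by metis
    then have "{i \<in> {1..n - 1}. (c = (0, 0) \<or> fst c = i) \<and> (d = (0, 0) \<or> fst d = i)} = {i}"
      by simp
    with True show ?thesis
      unfolding E by simp
  next
    case False
    then have "{i \<in> {1..n - 1}. (c = (0, 0) \<or> fst c = i) \<and> (d = (0, 0) \<or> fst d = i)} = {}"
      by auto
    with False show ?thesis
      unfolding E by simp
  qed
qed

lemma seidel_mat_hyperstar:
  assumes "distinct vs" and "set vs = hyperstar_verts n k"
  shows "seidel_mat vs (hyperstar_edges n k) = fun_mat vs vs hyperstar_seidel"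
proof (rule eq_matI)
  fix i j
  assume "i < dim_row (fun_mat vs vs hyperstar_seidel)"
    and "j < dim_col (fun_mat vs vs hyperstar_seidel)"
  then have ij: "i < length vs" "j < length vs" by simp_all
  then have mem: "vs ! i \<in> hyperstar_verts n k" "vs ! j \<in> hyperstar_verts n k"
    using assms(2) by (metis nth_mem)+
  have "vs ! i = vs ! j \<longleftrightarrow> i = j"
    using assms(1) ij by (simp add: nth_eq_iff_index_eq)
  \<comment> \<open>Disabling \<open>insert_subset\<close> keeps \<open>{c, d} \<subseteq> e\<close>
    in the form used by the counting lemma.\<close>
  then show "seidel_mat vs (hyperstar_edges n k) $$ (i, j) = fun_mat vs vs hyperstar_seidel $$ (i, j)"
    using ij card_hyperstar_edges_containing [OF mem]
    by (auto simp: seidel_mat_def all_ones_mat_def adjacency_mat_def hyperstar_seidel_def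
        simp del: insert_subset)
qed (simp_all add: seidel_mat_def all_ones_mat_def adjacency_mat_def)

section \<open>The tree basis and its dual\<close>

text \<open>\<open>(0, 0)\<close> and \<open>(1, 1)\<close> have no parent, so every use below is
  guarded by \<open>b \<in> {(0, 0), (1, 1)}\<close>.\<close>

definition hyperstar_parent :: "nat \<times> nat \<Rightarrow> nat \<times> nat" where
  "hyperstar_parent b = (if snd b = 1 then (1, 1) else (fst b, 1))"

text \<open>Column \<open>b\<close> is the basis vector \<open>p\<^sub>b\<close>; the dual basis consists of the indicator functions of the
  sets \<open>hyperstar_descendants n k a\<close>.\<close>

definition hyperstar_basis :: "nat \<times> nat \<Rightarrow> nat \<times> nat \<Rightarrow> real" where
  "hyperstar_basis d b =
     of_bool (d = b) - (if b \<in> {(0, 0), (1, 1)} then 0 else of_bool (d = hyperstar_parent b))"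

definition hyperstar_descendants :: "nat \<Rightarrow> nat \<Rightarrow> nat \<times> nat \<Rightarrow> (nat \<times> nat) set" where
  "hyperstar_descendants n k a =
     (if a = (1, 1) then {1..n - 1} \<times> {1..k - 1}
      else if snd a = 1 then {fst a} \<times> {1..k - 1} else {a})"

text \<open>This evaluates the linear functional with coefficients \<open>f\<close> at the basis
  vector \<open>p\<^sub>b\<close>.\<close>

lemma sum_hyperstar_basis:
  assumes "n \<ge> 2" and "k \<ge> 2" and "b \<in> hyperstar_verts n k"
  shows "(\<Sum>d\<in>hyperstar_verts n k. f d * hyperstar_basis d b) =
    f b - (if b \<in> {(0, 0), (1, 1)} then 0 else f (hyperstar_parent b))"
proof -
  have fin: "finite (hyperstar_verts n k)"
    by (simp add: hyperstar_verts_def)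
  have "hyperstar_parent b \<in> hyperstar_verts n k" if "b \<notin> {(0, 0), (1, 1)}"
    using assms that by (auto simp: hyperstar_verts_def hyperstar_parent_def)
  then show ?thesis
    using assms(3) fin
    by (cases "b \<in> {(0, 0), (1, 1)}")
      (simp_all add: hyperstar_basis_def right_diff_distrib sum_subtractf del: insert_iff)
qed

lemma sum_hyperstar_descendants:
  fixes f :: "nat \<times> nat \<Rightarrow> real"
  assumes "a \<in> hyperstar_verts n k"
  shows "(\<Sum>c\<in>hyperstar_verts n k. of_bool (c \<in> hyperstar_descendants n k a) * f c) =
    (\<Sum>c\<in>hyperstar_descendants n k a. f c)"
proof -
  have fin: "finite (hyperstar_verts n k)"
    by (simp add: hyperstar_verts_def)
  have "hyperstar_descendants n k a \<subseteq> hyperstar_verts n k"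
    using assms by (auto simp: hyperstar_verts_def hyperstar_descendants_def split: if_splits)
  then have "hyperstar_verts n k \<inter> hyperstar_descendants n k a = hyperstar_descendants n k a"
    by blast
  with fin show ?thesis
    by (simp add: of_bool_def if_distrib [of "\<lambda>x. x * _"] sum.If_cases cong: if_cong)
qed

text \<open>If \<open>b\<close> has a parent, the indicator of the subtree at \<open>a\<close> is
  nonzero on \<open>p\<^sub>b\<close> only when the subtree contains \<open>b\<close> but not that
  parent, that is, when \<open>a = b\<close>. The two parentless vertices lie in no subtree but
  their own.\<close>

lemma hyperstar_basis_dual:
  assumes "n \<ge> 2" and "k \<ge> 2" and "a \<in> hyperstar_verts n k" and "b \<in> hyperstar_verts n k"
  shows "(\<Sum>c\<in>hyperstar_verts n k.
    of_bool (c \<in> hyperstar_descendants n k a) * hyperstar_basis c b) = of_bool (a = b)"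
proof -
  let ?c = "if b \<in> {(0, 0), (1, 1)} then 0
    else of_bool (hyperstar_parent b \<in> hyperstar_descendants n k a) :: real"
  have "of_bool (b \<in> hyperstar_descendants n k a) - ?c = of_bool (a = b)"
    using assms(3)
  proof (cases rule: hyperstar_verts_cases)
    case center
    show ?thesis
      using assms(4) unfolding center
      by (cases rule: hyperstar_verts_cases) (auto simp: hyperstar_descendants_def hyperstar_parent_def)
  next
    case top
    show ?thesis
      using assms(4) unfolding top
      by (cases rule: hyperstar_verts_cases)
        (use assms(1,2) in \<open>auto simp: hyperstar_descendants_def hyperstar_parent_def\<close>)
  next
    case (root i)
    show ?thesis
      using assms(4) unfolding root(1)
      by (cases rule: hyperstar_verts_cases)
        (use assms(1,2) root(2) in \<open>auto simp: hyperstar_descendants_def hyperstar_parent_def\<close>)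
  next
    case (leaf i j)
    show ?thesis
      using assms(4) unfolding leaf(1)
      by (cases rule: hyperstar_verts_cases)
        (use leaf(2,3) in \<open>auto simp: hyperstar_descendants_def hyperstar_parent_def\<close>)
  qed
  then show ?thesis
    by (simp add: sum_hyperstar_basis [OF assms(1,2,4)])
qed

section \<open>Column sums, and the Seidel operator in the tree basis\<close>

text \<open>In its own block a vertex meets itself with entry 0 and \<open>k - 2\<close> twins with
  entry -1; in another block all \<open>k - 1\<close> entries are 1.\<close>

lemma sum_hyperstar_seidel_block:
  assumes "i \<ge> 1" and "i' \<ge> 1" and "j \<in> {1..k - 1}"
  shows "(\<Sum>c\<in>{i} \<times> {1..k - 1}. hyperstar_seidel c (i', j)) =
    (if i = i' then 1 - real (k - 1) else real (k - 1))"
proof (cases "i = i'")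
  case True
  have "(\<Sum>c\<in>{i} \<times> {1..k - 1}. hyperstar_seidel c (i', j)) =
      (\<Sum>c\<in>{i} \<times> {1..k - 1}. of_bool (c = (i', j)) - 1)"
    by (rule sum.cong) (use assms True in \<open>auto simp: hyperstar_seidel_def\<close>)
  also have "\<dots> = 1 - real (k - 1)"
    using assms True by (simp add: sum_subtractf)
  finally show ?thesis using True by simp
next
  case False
  have "(\<Sum>c\<in>{i} \<times> {1..k - 1}. hyperstar_seidel c (i', j)) = (\<Sum>c\<in>{i} \<times> {1..k - 1}. 1)"
    by (rule sum.cong) (use assms False in \<open>auto simp: hyperstar_seidel_def\<close>)
  then show ?thesis using False by simp
qed

text \<open>The value depends on neither \<open>i'\<close> nor \<open>j\<close>, so it cancels in
  differences of columns.\<close>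

lemma sum_hyperstar_seidel_blocks:
  assumes "i' \<in> {1..n - 1}" and "j \<in> {1..k - 1}"
  shows "(\<Sum>c\<in>{1..n - 1} \<times> {1..k - 1}. hyperstar_seidel c (i', j)) =
    real (k - 1) * (real n - 3) + 1"
proof -
  have "(\<Sum>c\<in>{1..n - 1} \<times> {1..k - 1}. hyperstar_seidel c (i', j)) =
      (\<Sum>i\<in>{1..n - 1}. \<Sum>c\<in>{i} \<times> {1..k - 1}. hyperstar_seidel c (i', j))"
    by (simp add: sum.cartesian_product' flip: sum.cartesian_product)
  \<comment> \<open>Every block is counted with \<open>k - 1\<close>, and the block of
    \<open>i'\<close> gets a correction.\<close>
  also have "\<dots> = (\<Sum>i\<in>{1..n - 1}. real (k - 1) + of_bool (i = i') * (1 - 2 * real (k - 1)))"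
    by (rule sum.cong [OF refl], subst sum_hyperstar_seidel_block) (use assms in auto)
  also have "\<dots> = real (n - 1) * real (k - 1) + (1 - 2 * real (k - 1))"
    using assms by (simp add: sum.distrib)
  \<comment> \<open>No truncation occurs: \<open>i' \<in> {1..n - 1}\<close> forces
    \<open>n \<ge> 2\<close>.\<close>
  also have "real (n - 1) = real n - 1"
    using assms by auto
  also have "(real n - 1) * real (k - 1) + (1 - 2 * real (k - 1)) = real (k - 1) * (real n - 3) + 1"
    by (simp add: algebra_simps)
  finally show ?thesis .
qed

text \<open>The matrix of the Seidel operator in the basis \<open>p\<close>.\<close>

definition hyperstar_reduced :: "nat \<Rightarrow> nat \<Rightarrow> nat \<times> nat \<Rightarrow> nat \<times> nat \<Rightarrow> real" where
  "hyperstar_reduced n k a b =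
     (\<Sum>c\<in>hyperstar_descendants n k a. hyperstar_seidel c b) -
     (if b \<in> {(0, 0), (1, 1)} then 0
      else \<Sum>c\<in>hyperstar_descendants n k a. hyperstar_seidel c (hyperstar_parent b))"

text \<open>The order \<open>ws\<close> of the basis is independent of the numbering
  \<open>vs\<close>, so it can be chosen to make the matrix block triangular.\<close>

lemma char_poly_seidel_mat_hyperstar_reduced:
  assumes n: "n \<ge> 2" and k: "k \<ge> 2"
    and vs: "distinct vs" "set vs = hyperstar_verts n k"
    and ws: "distinct ws" "set ws = hyperstar_verts n k"
  shows "char_poly (seidel_mat vs (hyperstar_edges n k)) =
    char_poly (fun_mat ws ws (hyperstar_reduced n k))"
proof -
  have "length vs = length ws"
    using vs ws by (metis distinct_card)
  then have "char_poly (fun_mat vs vs hyperstar_seidel) =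
      char_poly (fun_mat ws ws (\<lambda>a b. \<Sum>d\<in>set vs.
        (\<Sum>c\<in>set vs. of_bool (c \<in> hyperstar_descendants n k a) * hyperstar_seidel c d) *
        hyperstar_basis d b))"
    by (rule char_poly_fun_mat_change_basis [OF vs(1) ws(1)])
      (use n k in \<open>simp add: vs(2) ws(2) hyperstar_basis_dual\<close>)
  also have "\<dots> = char_poly (fun_mat ws ws (hyperstar_reduced n k))"
    by (rule arg_cong [OF fun_mat_cong])
      (use n k in \<open>simp add: vs(2) ws(2) sum_hyperstar_basis sum_hyperstar_descendants
        hyperstar_reduced_def\<close>)
  finally show ?thesis
    by (simp add: seidel_mat_hyperstar [OF vs])
qed

text \<open>Sums over whole blocks agree for the columns of the twins \<open>(i, j)\<close> and
  \<open>(i, 1)\<close>. At a single vertex the two columns differ only if it is one of the twins;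
  the coordinate at \<open>(i, j)\<close> is 0 - (-1) = 1.\<close>

lemma hyperstar_reduced_same_block:
  assumes a: "a \<in> hyperstar_verts n k" and i: "i \<in> {1..n - 1}" and j: "j \<in> {2..k - 1}"
  shows "hyperstar_reduced n k a (i, j) = of_bool (a = (i, j))"
proof -
  have js: "j \<in> {1..k - 1}" "1 \<in> {1..k - 1}" and i1: "i \<ge> 1"
    using i j by auto
  from a consider "a = (0, 0)" | "a = (1, 1)" | i' where "a = (i', 1)" "i' \<ge> 2"
    | i' j' where "a = (i', j')" "i' \<ge> 1" "j' \<ge> 2"
    by (cases a) (force simp: hyperstar_verts_def)
  then show ?thesis
  proof cases
    case 1
    with i j show ?thesis
      by (auto simp: hyperstar_reduced_def hyperstar_descendants_def hyperstar_parent_def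
          hyperstar_seidel_def)
  next
    case 2
    have "hyperstar_descendants n k a = {1..n - 1} \<times> {1..k - 1}"
      using 2 by (simp add: hyperstar_descendants_def)
    with 2 i j show ?thesis
      unfolding hyperstar_reduced_def
      by (auto simp: hyperstar_parent_def sum_hyperstar_seidel_blocks [OF i js(1), simplified]
          sum_hyperstar_seidel_blocks [OF i js(2), simplified])
  next
    case 3
    have d: "hyperstar_descendants n k a = {i'} \<times> {1..k - 1}" and i': "i' \<ge> 1"
      using 3 by (simp_all add: hyperstar_descendants_def)
    show ?thesis
      using 3 j unfolding hyperstar_reduced_def d
      by (auto simp: hyperstar_parent_def sum_hyperstar_seidel_block [OF i' i1 js(1), simplified]
          sum_hyperstar_seidel_block [OF i' i1 js(2), simplified])
  next
    case 4
    with i j show ?thesis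
      by (auto simp: hyperstar_reduced_def hyperstar_descendants_def hyperstar_parent_def
          hyperstar_seidel_def)
  qed
qed

text \<open>Leaf coordinates are excluded because they need not vanish. Block \<open>i\<close>
  contains \<open>(i, 1)\<close> but not its parent \<open>(1, 1)\<close>, which gives
  \<open>(1 - (k - 1)) - (k - 1)\<close>; blocks \<open>i' \<ge> 2\<close> other than
  \<open>i\<close> contain neither, and their sums cancel.\<close>

lemma hyperstar_reduced_block_roots:
  assumes k: "k \<ge> 2" and a: "a \<in> {(0, 0), (1, 1)} \<or> (\<exists>i'\<ge>2. a = (i', 1))"
    and i: "i \<in> {2..n - 1}"
  shows "hyperstar_reduced n k a (i, 1) = (if a = (i, 1) then 3 - 2 * real k else 0)"
proof -
  have k1: "1 \<in> {1..k - 1}" and i1: "i \<ge> 1" and n1: "i \<in> {1..n - 1}" "1 \<in> {1..n - 1}"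
    using i k by auto
  from a consider "a = (0, 0)" | "a = (1, 1)" | i' where "a = (i', 1)" "i' \<ge> 2"
    by blast
  then show ?thesis
  proof cases
    case 1
    with i show ?thesis
      by (auto simp: hyperstar_reduced_def hyperstar_descendants_def hyperstar_parent_def
          hyperstar_seidel_def)
  next
    case 2
    have "hyperstar_descendants n k a = {1..n - 1} \<times> {1..k - 1}"
      using 2 by (simp add: hyperstar_descendants_def)
    with 2 i show ?thesis
      unfolding hyperstar_reduced_def
      by (auto simp: hyperstar_parent_def sum_hyperstar_seidel_blocks [OF n1(1) k1, simplified]
          sum_hyperstar_seidel_blocks [OF n1(2) k1, simplified])
  next
    case 3
    have d: "hyperstar_descendants n k a = {i'} \<times> {1..k - 1}" and i': "i' \<ge> 1"
      using 3 by (simp_all add: hyperstar_descendants_def)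
    show ?thesis
      using 3 i k unfolding hyperstar_reduced_def d
      by (auto simp: hyperstar_parent_def sum_hyperstar_seidel_block [OF i' i1 k1, simplified]
          sum_hyperstar_seidel_block [OF i' order.refl k1, simplified] of_nat_diff)
  qed
qed

text \<open>These four entries form the two-dimensional quotient that produces the quadratic
  factor.\<close>

lemma hyperstar_reduced_top:
  assumes n: "n \<ge> 2" and k: "k \<ge> 2"
  shows "hyperstar_reduced n k (0, 0) (0, 0) = 0"
    and "hyperstar_reduced n k (0, 0) (1, 1) = - 1"
    and "hyperstar_reduced n k (1, 1) (0, 0) = - ((real n - 1) * (real k - 1))"
    and "hyperstar_reduced n k (1, 1) (1, 1) = (real k - 1) * (real n - 3) + 1"
proof -
  have "(\<Sum>c\<in>{1..n - 1} \<times> {1..k - 1}. hyperstar_seidel c (0, 0)) =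
      (\<Sum>c\<in>{1..n - 1} \<times> {1..k - 1}. - 1)"
    by (rule sum.cong) (auto simp: hyperstar_seidel_def)
  then show "hyperstar_reduced n k (1, 1) (0, 0) = - ((real n - 1) * (real k - 1))"
    using n k by (simp add: hyperstar_reduced_def hyperstar_descendants_def of_nat_diff)
  have "1 \<in> {1..n - 1}" "1 \<in> {1..k - 1}"
    using n k by auto
  from sum_hyperstar_seidel_blocks [OF this]
  show "hyperstar_reduced n k (1, 1) (1, 1) = (real k - 1) * (real n - 3) + 1"
    using k by (simp add: hyperstar_reduced_def hyperstar_descendants_def of_nat_diff)
qed (simp_all add: hyperstar_reduced_def hyperstar_descendants_def hyperstar_seidel_def)

section \<open>Characteristic polynomial and spectrum\<close>

lemma char_poly_seidel_mat_hyperstar: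
  assumes n: "n \<ge> 2" and k: "k \<ge> 2"
    and vs: "distinct vs" "set vs = hyperstar_verts n k"
  shows "char_poly (seidel_mat vs (hyperstar_edges n k)) =
    [: - ((real n - 1) * (real k - 1)), - ((real k - 1) * (real n - 3) + 1), 1 :] *
    ([:- (3 - 2 * real k), 1:] ^ (n - 2) * [:- 1, 1:] ^ ((n - 1) * (k - 2)))"
proof -
  \<comment> \<open>In the order \<open>top\<close>, \<open>roots\<close>, \<open>leaves\<close> the
    matrix is block lower triangular. The half-open ranges end at \<open>n - 1\<close> and
    \<open>k - 1\<close>, giving lengths \<open>n - 2\<close> and
    \<open>(n - 1) * (k - 2)\<close>.\<close>
  define top where "top = [(0::nat, 0::nat), (1, 1)]"
  define roots where "roots = map (\<lambda>i. (i, 1::nat)) [2..<n]"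
  define leaves where "leaves = List.product [1..<n] [2..<k]"
  let ?F = "hyperstar_reduced n k"
  have dist: "distinct (top @ roots @ leaves)"
    by (auto simp: top_def roots_def leaves_def distinct_map distinct_product inj_on_def)
  have set: "set (top @ roots @ leaves) = hyperstar_verts n k"
    using n k by (force simp: top_def roots_def leaves_def hyperstar_verts_def)
  have leaf: "?F a b = (if a = b then 1 else 0)"
    if "a \<in> set (top @ roots @ leaves)" "b \<in> set leaves" for a b
    using that hyperstar_reduced_same_block [of a n k "fst b" "snd b"]
    unfolding set by (auto simp: leaves_def)
  have root: "?F a b = (if a = b then 3 - 2 * real k else 0)"
    if ab: "a \<in> set (top @ roots)" "b \<in> set roots" for a b
  proof -
    obtain i where i: "b = (i, 1)" "i \<in> {2..n - 1}"
      using ab(2) by (auto simp: roots_def)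
    moreover have "a \<in> {(0, 0), (1, 1)} \<or> (\<exists>i'\<ge>2. a = (i', 1))"
      using ab(1) by (auto simp: top_def roots_def)
    ultimately show ?thesis
      using hyperstar_reduced_block_roots [OF k, of a i n] by simp
  qed
  have "char_poly (seidel_mat vs (hyperstar_edges n k)) =
      char_poly (fun_mat (top @ roots @ leaves) (top @ roots @ leaves) ?F)"
    by (rule char_poly_seidel_mat_hyperstar_reduced [OF n k vs dist set])
  also have "\<dots> = char_poly (fun_mat top top ?F) *
      char_poly (fun_mat (roots @ leaves) (roots @ leaves) ?F)"
    by (rule char_poly_fun_mat_append) (use dist root leaf in auto)
  also have "char_poly (fun_mat (roots @ leaves) (roots @ leaves) ?F) =
      char_poly (fun_mat roots roots ?F) * char_poly (fun_mat leaves leaves ?F)"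
    by (rule char_poly_fun_mat_append) (use dist leaf in auto)
  also have "char_poly (fun_mat roots roots ?F) = [:- (3 - 2 * real k), 1:] ^ length roots"
    by (rule char_poly_fun_mat_diag) (use dist root in auto)
  also have "char_poly (fun_mat leaves leaves ?F) = [:- 1, 1:] ^ length leaves"
    by (rule char_poly_fun_mat_diag) (use dist leaf in auto)
  also have "char_poly (fun_mat top top ?F) =
      [: - ((real n - 1) * (real k - 1)), - ((real k - 1) * (real n - 3) + 1), 1 :]"
    unfolding top_def char_poly_fun_mat_pair hyperstar_reduced_top [OF n k] by simp
  finally show ?thesis
    by (simp add: roots_def leaves_def)
qed

theorem theorem4p2:
  fixes n k :: nat and vs :: "(nat \<times> nat) list"
  assumes "n \<ge> 2" and "k \<ge> 2"
    and "distinct vs" and "set vs = hyperstar_verts n k"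
  shows "\<exists>r1 r2 :: real.
    proots [: - ((real n - 1) * (real k - 1)), - ((real k - 1) * (real n - 3) + 1), 1 :] = {# r1, r2 #} \<and>
    seidel_spectrum vs (hyperstar_edges n k) =
      replicate_mset ((n - 1) * (k - 2)) 1 + replicate_mset (n - 2) (3 - 2 * real k) + {# r1, r2 #}"
proof -
  let ?q = "[: - ((real n - 1) * (real k - 1)), - ((real k - 1) * (real n - 3) + 1), 1 :]"
  have "0 \<le> (real n - 1) * (real k - 1)"
    using assms(1,2) by simp
  then obtain r1 r2 where "?q = [:- r1, 1:] * [:- r2, 1:]"
    by (rule quadratic_nonpos_constant_factors)
  \<comment> \<open>The product is kept unexpanded so that \<open>proots_mult\<close> can read off
    the roots.\<close>
  then have q: "proots ?q = {# r1, r2 #}"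
    by (simp add: proots_mult del: mult_pCons_left mult_pCons_right)
  have "seidel_spectrum vs (hyperstar_edges n k) =
      proots ?q + (proots ([:- (3 - 2 * real k), 1:] ^ (n - 2)) +
        proots ([:- 1, 1:] ^ ((n - 1) * (k - 2))))"
    unfolding seidel_spectrum_def mat_spectrum_def char_poly_seidel_mat_hyperstar [OF assms]
    by (subst proots_mult; simp add: proots_mult del: mult_pCons_left mult_pCons_right)
  also have "\<dots> = replicate_mset ((n - 1) * (k - 2)) 1 + replicate_mset (n - 2) (3 - 2 * real k) +
      {# r1, r2 #}"
    unfolding q proots_linear_power by simp
  finally show ?thesis
    using q by blast
qed

end
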